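(* Let $N\ge 0$ be an integer and let $A,B$ be non-negative integers with $A+B=N$, $A\neq 0$ and $B\neq 0$ (so that neither $(A,B)$ nor $(B,A)$ is the root $(0,N)$). If $(A,B)$ is at depth $d$ in the CVT-XOR Tree with root $(0,N)$, then $(B,A)$ is also at depth $d$. (By contrast, the root $(0,N)$ is at depth $0$ while $(N,0)$ is at depth $1$.)
   Context: For non-negative integers $X,Y$ written in binary, $\mathrm{XOR}(X,Y)$ is their bitwise exclusive or, and $\mathrm{CVT}(X,Y)=2\cdot(X \mathbin{\mathrm{AND}} Y)$ (bitwise AND shifted one position left). Define $f(X,Y)=(\mathrm{CVT}(X,Y),\mathrm{XOR}(X,Y))$; $f$ preserves the sum $X+Y$, and for every pair of non-negative integers iterating $f$ eventually reaches $(0,X+Y)$, which is fixed by $f$. The CVT-XOR Tree with root $(0,N)$ has as nodes all pairs $(X,Y)$ of non-negative integers with $X+Y=N$, the parent of a non-root node $(X,Y)$ being $f(X,Y)$. The depth of a node $(X,Y)$ is the least $k\ge 0$ such that $f^k(X,Y)=(0,N)$. *)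

theory Defs
  imports Main
begin

context
  includes bit_operations_syntax
begin

definition CVT :: "nat \<Rightarrow> nat \<Rightarrow> nat" where
  "CVT X Y = 2 * (X AND Y)"

definition cvt_xor :: "nat \<times> nat \<Rightarrow> nat \<times> nat" where
  "cvt_xor = (\<lambda>(X, Y). (CVT X Y, X XOR Y))"

definition tree_nodes :: "nat \<Rightarrow> (nat \<times> nat) set" where
  "tree_nodes N = {(X, Y). X + Y = N}"

definition tree_root :: "nat \<Rightarrow> nat \<times> nat" where
  "tree_root N = (0, N)"

text \<open>
  Away from the root, the parent of a node is its image under \<^const>\<open>cvt_xor\<close>.
  By \<open>cvt_xor_reaches_root\<close> below, the minimum in \<open>tree_depth\<close> exists for every node.
\<close>

definition tree_depth :: "nat \<Rightarrow> nat \<times> nat \<Rightarrow> nat" where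
  "tree_depth N p = (LEAST k. (cvt_xor ^^ k) p = tree_root N)"

lemma CVT_add_xor: "CVT X Y + (X XOR Y) = X + Y"
proof (induction X arbitrary: Y rule: less_induct)
  case (less X)
  show ?case
  proof (cases "X = 0")
    case True
    then show ?thesis by (simp add: CVT_def)
  next
    case False
    then have IH: "2 * (X div 2 AND Y div 2) + (X div 2 XOR Y div 2) = X div 2 + Y div 2"
      using less.IH [of "X div 2" "Y div 2"] by (simp add: CVT_def)
    have "2 * (X AND Y) + (X XOR Y) =
      2 * of_bool (odd X \<and> odd Y) + of_bool (odd X \<noteq> odd Y)
        + 2 * (2 * (X div 2 AND Y div 2) + (X div 2 XOR Y div 2))"
      by (subst and_rec, subst xor_rec) simp
    also have "\<dots> = X + Y"
      unfolding IH by (cases "odd X"; cases "odd Y") (auto elim!: oddE evenE)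
    finally show ?thesis by (simp add: CVT_def)
  qed
qed

end

lemma cvt_xor_in_tree_nodes: "p \<in> tree_nodes N \<Longrightarrow> cvt_xor p \<in> tree_nodes N"
  by (auto simp: tree_nodes_def cvt_xor_def CVT_add_xor)

lemma cvt_xor_root: "cvt_xor (tree_root N) = tree_root N"
  by (simp add: cvt_xor_def tree_root_def CVT_def)

lemma cvt_xor_reaches_root:
  assumes "p \<in> tree_nodes N"
  shows "\<exists>k. (cvt_xor ^^ k) p = tree_root N"
proof -
  have inv: "(cvt_xor ^^ k) p \<in> tree_nodes N \<and> take_bit k (fst ((cvt_xor ^^ k) p)) = 0" for k
  proof (induction k)
    case 0
    then show ?case using assms by simp
  next
    case (Suc k)
    obtain X Y where XY: "(cvt_xor ^^ k) p = (X, Y)" by fastforce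
    have "take_bit k X = 0" using Suc XY by simp
    then have "take_bit (Suc k) (CVT X Y) = 0"
      by (simp add: CVT_def take_bit_Suc)
    then show ?case
      using Suc XY cvt_xor_in_tree_nodes [of "(X, Y)" N] by (simp add: cvt_xor_def)
  qed
  obtain X Y where XY: "(cvt_xor ^^ N) p = (X, Y)" by fastforce
  have "X + Y = N" "take_bit N X = 0"
    using inv [of N] XY by (auto simp: tree_nodes_def)
  moreover have "X < 2 ^ N"
    using \<open>X + Y = N\<close> less_exp [of N] by linarith
  ultimately have "X = 0" "Y = N"
    by (simp_all add: take_bit_nat_eq_self)
  then show ?thesis
    using XY by (auto simp: tree_root_def)
qed

end

theory Submission
  imports Defs
begin

text \<open>AND and XOR are commutative, so \<open>(A, B)\<close> and \<open>(B, A)\<close> have the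
  same image under \<open>cvt_xor\<close> and their orbits agree from the first iterate on
  (\<open>funpow_cvt_xor_swap\<close>). Their depths can thus differ only through iterate 0, that
  is, if one of the pairs is itself the root.\<close>

lemma cvt_xor_swap: "cvt_xor (A, B) = cvt_xor (B, A)"
  by (simp add: cvt_xor_def CVT_def and.commute xor.commute)

lemma funpow_cvt_xor_swap:
  assumes "k \<noteq> 0"
  shows "(cvt_xor ^^ k) (A, B) = (cvt_xor ^^ k) (B, A)"
  \<comment> \<open>\<open>funpow_Suc_right\<close> peels off the innermost application, where the
    swap happens; \<open>funpow.simps\<close> would peel off the outermost.\<close>
  using assms by (cases k) (simp_all add: funpow_Suc_right cvt_xor_swap del: funpow.simps)

lemma tree_depth_swap:
  assumes "A \<noteq> 0" "B \<noteq> 0"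
  shows "tree_depth N (A, B) = tree_depth N (B, A)"
proof -
  have "(cvt_xor ^^ k) (A, B) = tree_root N \<longleftrightarrow> (cvt_xor ^^ k) (B, A) = tree_root N" for k
    \<comment> \<open>At \<open>k = 0\<close> both sides are false: the root has first component
      0.\<close>
    using assms funpow_cvt_xor_swap [of k A B] by (cases "k = 0") (auto simp: tree_root_def)
  then show ?thesis
    by (simp add: tree_depth_def)
qed

lemma tree_depth_root: "tree_depth N (tree_root N) = 0"
  by (simp add: tree_depth_def)

text \<open>For \<open>N = 0\<close> the pair \<open>(N, 0)\<close> is the root itself, at depth
  0.\<close>

lemma tree_depth_root_swapped:
  assumes "N \<noteq> 0"
  shows "tree_depth N (N, 0) = 1"
  unfolding tree_depth_def
proof (rule Least_equality)
  show "(cvt_xor ^^ 1) (N, 0) = tree_root N"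
    by (simp add: cvt_xor_def CVT_def tree_root_def)
  show "1 \<le> k" if "(cvt_xor ^^ k) (N, 0) = tree_root N" for k
    using that assms by (cases k) (auto simp: tree_root_def)
qed

theorem theorem2:
  fixes N :: nat
  shows "(\<forall>A B d. (A, B) \<in> tree_nodes N \<longrightarrow> A \<noteq> 0 \<longrightarrow> B \<noteq> 0 \<longrightarrow>
            tree_depth N (A, B) = d \<longrightarrow> tree_depth N (B, A) = d) \<and>
         tree_depth N (tree_root N) = 0 \<and>
         (N \<noteq> 0 \<longrightarrow> tree_depth N (N, 0) = 1)"
  using tree_depth_swap tree_depth_root tree_depth_root_swapped by simp

end
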